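(* There exist numbers $C_{\alpha_1,\dots,\alpha_s}^{s,m,k+1}$ (not depending on $u$), indexed by integers $k\ge1$, $1\le s\le k$, $1\le m\le s$ and nonnegative integers $\alpha_1,\dots,\alpha_s$ with $\sum_{i=1}^s\alpha_i=m$ and $\sum_{i=1}^s i\alpha_i=s$, such that for every entire or meromorphic function $u$ on $\mathbb{C}$ and every integer $k\ge0$ the operator $A=u(z)\frac{d}{dz}$ satisfies $$A^{k+1}=\sum_{s=1}^{k+1}P_{k+1}^{s}(u)\Big(\frac{d}{dz}\Big)^{s},$$ where $$P_{k+1}^{k+1}(u)=u^{k+1},\qquad P_{k+1}^{k+1-s}(u)=\sum_{m=1}^{s}u^{k+1-m}\sum_{m,s}C_{\alpha_1,\dots,\alpha_s}^{s,m,k+1}\Big(\frac{du}{dz}\Big)^{\alpha_1}\cdots\Big(\frac{d^su}{dz^s}\Big)^{\alpha_s},\quad s=1,\dots,k.$$ Moreover these numbers satisfy the following recurrence relations for $s=1,\dots,k-1$. (i) For $1<m<s+1$ and nonnegative integers $\gamma_1,\dots,\gamma_{s+1}$ with $\gamma_{s+1}=0$, $\sum_{i=1}^{s+1}\gamma_i=m$, $\sum_{i=1}^{s+1}i\gamma_i=s+1$: $$C_{\gamma_1,\dots,\gamma_s,\gamma_{s+1}}^{s+1,m,k+1}=\sum_{t=s+1}^{k}\Big[(t+1-m)\,C_{\gamma_1-1,\gamma_2,\dots,\gamma_s}^{s,m-1,t}+\sum_{j=1}^{s-1}(\gamma_j+1)\,C_{\gamma_1,\dots,\gamma_{j-1},\gamma_j+1,\gamma_{j+1}-1,\gamma_{j+2},\dots,\gamma_s}^{s,m,t}\Big].$$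 (ii) For nonnegative integers $\gamma_1,\dots,\gamma_{s+1}$ with $\gamma_{s+1}=0$, $\sum_{i=1}^{s+1}\gamma_i=s+1$, $\sum_{i=1}^{s+1}i\gamma_i=s+1$: $$C_{\gamma_1,\dots,\gamma_s,\gamma_{s+1}}^{s+1,s+1,k+1}=\sum_{t=s+1}^{k}(t-s)\,C_{\gamma_1-1,\gamma_2,\dots,\gamma_s}^{s,s,t}.$$ (iii) $$C_{\underbrace{0,\dots,0}_{s},1}^{s+1,1,k+1}=\sum_{t=s+1}^{k}C_{\underbrace{0,\dots,0}_{s-1},1}^{s,1,t}.$$
   Context: $\sum_{m,s}$ denotes summation over all tuples of nonnegative integers $(\alpha_1,\dots,\alpha_s)$ with $\sum_{i=1}^s\alpha_i=m$ and $\sum_{i=1}^s i\alpha_i=s$. A symbol $C$ with a negative lower index is interpreted as $0$. $A^{k}$ is the $k$-fold composition of $A$ with itself; operators act on entire and meromorphic functions on $\mathbb{C}$. *)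

theory Defs
  imports "HOL-Complex_Analysis.Complex_Analysis"
begin

definition A_op :: "(complex \<Rightarrow> complex) \<Rightarrow> (complex \<Rightarrow> complex) \<Rightarrow> complex \<Rightarrow> complex" where
  "A_op u f = (\<lambda>z. u z * deriv f z)"

(* A tuple (\<alpha>_1, ..., \<alpha>_s) is a function on indices that is 0 outside {1..s}. Hence a tuple of
   length s + 1 with last entry 0 is the same function as its truncation to length s. *)
definition tuples :: "nat \<Rightarrow> nat \<Rightarrow> (nat \<Rightarrow> nat) set" where
  "tuples m s = {\<alpha>. (\<forall>i. i \<notin> {1..s} \<longrightarrow> \<alpha> i = 0) \<and>
                    (\<Sum>i=1..s. \<alpha> i) = m \<and> (\<Sum>i=1..s. i * \<alpha> i) = s}"

(* The family C is given as C s m n \<alpha>, where n is the third upper index (written k + 1 or t). *)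
type_synonym coeffs = "nat \<Rightarrow> nat \<Rightarrow> nat \<Rightarrow> (nat \<Rightarrow> nat) \<Rightarrow> complex"

(* A symbol with a negative lower index is 0. *)
definition symb :: "coeffs \<Rightarrow> nat \<Rightarrow> nat \<Rightarrow> nat \<Rightarrow> (nat \<Rightarrow> int) \<Rightarrow> complex" where
  "symb C s m n \<alpha> = (if \<exists>i. \<alpha> i < 0 then 0 else C s m n (\<lambda>i. nat (\<alpha> i)))"

(* P C n j is the coefficient with lower index n and upper index j, for 1 \<le> j \<le> n. *)
definition P :: "coeffs \<Rightarrow> nat \<Rightarrow> nat \<Rightarrow> (complex \<Rightarrow> complex) \<Rightarrow> complex \<Rightarrow> complex" where
  "P C n j u = (\<lambda>z.
     if j = n then u z ^ n
     else (let s = n - j in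
       \<Sum>m=1..s. u z ^ (n - m) *
         (\<Sum>\<alpha>\<in>tuples m s. C s m n \<alpha> * (\<Prod>i=1..s. ((deriv ^^ i) u z) ^ \<alpha> i))))"

(* The identity A^(k+1) = sum of P_(k+1)^s(u) (d/dz)^s between operators on meromorphic functions.
   For f, u meromorphic on the plane, as HOL functions, the values at poles are junk; both sides
   are compared at every point where u and f are analytic. The remaining points form a discrete
   closed set, so this gives equality as meromorphic functions, and equality everywhere if u and f
   are entire. *)
definition operator_expansion :: "coeffs \<Rightarrow> (complex \<Rightarrow> complex) \<Rightarrow> nat \<Rightarrow> bool" where
  "operator_expansion C u k \<longleftrightarrow>
     (\<forall>f. f meromorphic_on UNIV \<longrightarrow>
       (\<forall>z. u analytic_on {z} \<and> f analytic_on {z} \<longrightarrow>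
         (A_op u ^^ (k + 1)) f z = (\<Sum>s=1..k+1. P C (k + 1) s u z * (deriv ^^ s) f z)))"

end

(* Applying A once more to the sum over j of P_n^j (d/dz)^j gives P_(n+1)^j = u P_n^(j-1) + u (P_n^j)'.
   Differentiating u^(n-m) times the monomial of a tuple alpha and multiplying by u yields (n - m)
   times the term of alpha + e_1, and alpha_j times the term of alpha - e_j + e_(j+1). Collecting the
   contributions to a fixed tuple gives a recurrence in n for the coefficients, which is taken as
   their definition. The coefficient of weight s > 0 vanishes at n = s, so unrolling the recurrence
   down to n = s + 1 gives the three stated relations. *)
theory Submission
  imports Defs
begin

section \<open>Unit changes of a single exponent\<close>

definition inc :: "nat \<Rightarrow> (nat \<Rightarrow> nat) \<Rightarrow> nat \<Rightarrow> nat" where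
  "inc j \<alpha> = \<alpha>(j := \<alpha> j + 1)"

definition dec :: "nat \<Rightarrow> (nat \<Rightarrow> nat) \<Rightarrow> nat \<Rightarrow> nat" where
  "dec j \<alpha> = \<alpha>(j := \<alpha> j - 1)"

lemma inc_dec: "\<alpha> j > 0 \<Longrightarrow> inc j (dec j \<alpha>) = \<alpha>"
  by (auto simp: inc_def dec_def)

lemma dec_inc: "dec j (inc j \<alpha>) = \<alpha>"
  by (auto simp: inc_def dec_def)

lemma inc_same [simp]: "inc j \<alpha> j = \<alpha> j + 1" and inc_other [simp]: "i \<noteq> j \<Longrightarrow> inc j \<alpha> i = \<alpha> i"
  by (auto simp: inc_def)

lemma dec_same [simp]: "dec j \<alpha> j = \<alpha> j - 1" and dec_other [simp]: "i \<noteq> j \<Longrightarrow> dec j \<alpha> i = \<alpha> i"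
  by (auto simp: dec_def)

section \<open>Size and weight; tuples of a given weight\<close>

definition size_upto :: "nat \<Rightarrow> (nat \<Rightarrow> nat) \<Rightarrow> nat" where
  "size_upto N \<alpha> = (\<Sum>i=1..N. \<alpha> i)"

definition weight_upto :: "nat \<Rightarrow> (nat \<Rightarrow> nat) \<Rightarrow> nat" where
  "weight_upto N \<alpha> = (\<Sum>i=1..N. i * \<alpha> i)"

lemma size_upto_inc: "j \<in> {1..N} \<Longrightarrow> size_upto N (inc j \<alpha>) = size_upto N \<alpha> + 1"
  unfolding size_upto_def by (simp add: sum.remove[of _ j])

lemma weight_upto_inc: "j \<in> {1..N} \<Longrightarrow> weight_upto N (inc j \<alpha>) = weight_upto N \<alpha> + j"
  unfolding weight_upto_def by (simp add: sum.remove[of _ j])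

lemma size_upto_dec: "j \<in> {1..N} \<Longrightarrow> \<alpha> j > 0 \<Longrightarrow> size_upto N (dec j \<alpha>) + 1 = size_upto N \<alpha>"
  using size_upto_inc[of j N "dec j \<alpha>"] by (simp add: inc_dec)

lemma weight_upto_dec: "j \<in> {1..N} \<Longrightarrow> \<alpha> j > 0 \<Longrightarrow> weight_upto N (dec j \<alpha>) + j = weight_upto N \<alpha>"
  using weight_upto_inc[of j N "dec j \<alpha>"] by (simp add: inc_dec)

lemma size_le_weight: "size_upto N \<alpha> \<le> weight_upto N \<alpha>"
  unfolding size_upto_def weight_upto_def by (rule sum_mono) auto

text \<open>Letting the length \<open>N\<close> exceed the weight \<open>s\<close> keeps the shifts of tuples inside one type of
  index set.\<close>
definition tuples_upto :: "nat \<Rightarrow> nat \<Rightarrow> (nat \<Rightarrow> nat) set" where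
  "tuples_upto N s = {\<alpha>. (\<forall>i. i \<notin> {1..N} \<longrightarrow> \<alpha> i = 0) \<and> weight_upto N \<alpha> = s}"

text \<open>A nonzero entry at index \<open>i\<close> contributes at least \<open>i\<close> to the
  weight.\<close>

lemma tuples_upto_vanish:
  assumes "\<alpha> \<in> tuples_upto N s" "s < i"
  shows "\<alpha> i = 0"
proof (cases "i \<in> {1..N}")
  case True
  have "i * \<alpha> i \<le> weight_upto N \<alpha>"
    unfolding weight_upto_def using True by (intro member_le_sum) auto
  also have "\<dots> < i * 1"
    using assms by (simp add: tuples_upto_def)
  finally show ?thesis unfolding mult_less_cancel1 by simp
qed (use assms in \<open>auto simp: tuples_upto_def\<close>)

lemma finite_tuples_upto: "finite (tuples_upto N s)"
proof (rule finite_subset)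
  show "tuples_upto N s \<subseteq> {f. \<forall>i. (i \<in> {1..N} \<longrightarrow> f i \<in> {0..s}) \<and> (i \<notin> {1..N} \<longrightarrow> f i = 0)}"
  proof safe
    fix \<alpha> i assume \<alpha>: "\<alpha> \<in> tuples_upto N s" and i: "i \<in> {1..N}"
    have "\<alpha> i \<le> i * \<alpha> i" using i by simp
    also have "\<dots> \<le> weight_upto N \<alpha>"
      unfolding weight_upto_def using i by (intro member_le_sum) auto
    finally show "\<alpha> i \<in> {0..s}" using \<alpha> by (simp add: tuples_upto_def)
  qed (auto simp: tuples_upto_def)
  show "finite {f. \<forall>i. (i \<in> {1..N} \<longrightarrow> f i \<in> {0..s}) \<and> (i \<notin> {1..N} \<longrightarrow> f i = (0::nat))}"
    by (intro finite_set_of_finite_funs) auto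
qed

text \<open>The function \<open>h\<close> is left general so that size and weight are both
  instances.\<close>

lemma sum_upto_extend:
  fixes h :: "nat \<Rightarrow> nat \<Rightarrow> nat"
  assumes "s \<le> N" "\<And>i. i > s \<Longrightarrow> \<alpha> i = 0" "\<And>i. h i 0 = 0"
  shows "(\<Sum>i=1..N. h i (\<alpha> i)) = (\<Sum>i=1..s. h i (\<alpha> i))"
  by (rule sum.mono_neutral_right) (use assms in auto)

text \<open>Entries beyond the weight vanish, so allowing a greater length \<open>N\<close> adds no
  tuples, and the size can be read off at either length.\<close>

lemma tuples_iff_upto:
  assumes "s \<le> N"
  shows "\<alpha> \<in> tuples m s \<longleftrightarrow> \<alpha> \<in> tuples_upto N s \<and> size_upto N \<alpha> = m"
proof
  assume \<alpha>: "\<alpha> \<in> tuples m s"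
  then have "\<And>i. i > s \<Longrightarrow> \<alpha> i = 0" by (auto simp: tuples_def)
  from sum_upto_extend[OF assms this, where h = "\<lambda>i x. x"] sum_upto_extend[OF assms this, where h = "\<lambda>i x. i * x"] \<alpha> assms
  show "\<alpha> \<in> tuples_upto N s \<and> size_upto N \<alpha> = m"
    by (auto simp: tuples_def tuples_upto_def size_upto_def weight_upto_def)
next
  assume \<alpha>: "\<alpha> \<in> tuples_upto N s \<and> size_upto N \<alpha> = m"
  then have z: "\<And>i. i > s \<Longrightarrow> \<alpha> i = 0" using tuples_upto_vanish by blast
  from sum_upto_extend[OF assms z, where h = "\<lambda>i x. x"] sum_upto_extend[OF assms z, where h = "\<lambda>i x. i * x"] \<alpha>
  have "(\<Sum>i=1..s. \<alpha> i) = m" "(\<Sum>i=1..s. i * \<alpha> i) = s"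
    by (auto simp: tuples_upto_def size_upto_def weight_upto_def)
  moreover have "\<forall>i. i \<notin> {1..s} \<longrightarrow> \<alpha> i = 0"
  proof (intro allI impI)
    fix i assume "i \<notin> {1..s}"
    then have "i = 0 \<or> i > s" by auto
    then show "\<alpha> i = 0"
    proof
      assume "i = 0"
      then show ?thesis using \<alpha> by (simp add: tuples_upto_def)
    qed (use z in blast)
  qed
  ultimately show "\<alpha> \<in> tuples m s" by (simp add: tuples_def)
qed

text \<open>Each entry counts in the weight at least as much as in the size, and a tuple of size 0
  is zero. These bounds make coefficients with an impossible \<open>m\<close> vanish.\<close>

lemma tuples_bounds:
  assumes "\<alpha> \<in> tuples m s"
  shows "m \<le> s" and "s > 0 \<Longrightarrow> m > 0"
proof -
  have *: "size_upto s \<alpha> = m" "weight_upto s \<alpha> = s"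
    using assms tuples_iff_upto[of s s] by (auto simp: tuples_upto_def)
  then show "m \<le> s" using size_le_weight[of s \<alpha>] by simp
  show "m > 0" if "s > 0"
  proof (rule ccontr)
    assume "\<not> m > 0"
    then have "\<forall>i\<in>{1..s}. \<alpha> i = 0" using * by (simp add: size_upto_def)
    then have "weight_upto s \<alpha> = 0" by (simp add: weight_upto_def)
    then show False using * that by simp
  qed
qed

lemma tuples_zero: "\<alpha> \<in> tuples m 0 \<longleftrightarrow> m = 0 \<and> \<alpha> = (\<lambda>_. 0)"
  by (auto simp: tuples_def)

section \<open>Reindexing sums over tuples\<close>

text \<open>\<open>inc j\<close> is a bijection onto the tuples of weight \<open>s + j\<close> with
  nonzero entry at \<open>j\<close>, with inverse \<open>dec j\<close>. The two arguments of
  \<open>h\<close> keep the old tuple, which carries the coefficient, apart from the new one, which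
  carries the monomial.\<close>

lemma sum_tuples_upto_inc:
  fixes h :: "(nat \<Rightarrow> nat) \<Rightarrow> (nat \<Rightarrow> nat) \<Rightarrow> 'b::comm_monoid_add"
  assumes "j \<in> {1..N}"
  shows "(\<Sum>\<alpha>\<in>tuples_upto N s. h \<alpha> (inc j \<alpha>)) =
         (\<Sum>\<gamma>\<in>tuples_upto N (s + j). if \<gamma> j = 0 then 0 else h (dec j \<gamma>) \<gamma>)"
proof -
  have "(\<Sum>\<alpha>\<in>tuples_upto N s. h \<alpha> (inc j \<alpha>)) =
        (\<Sum>\<gamma>\<in>{\<gamma> \<in> tuples_upto N (s + j). \<gamma> j \<noteq> 0}. h (dec j \<gamma>) \<gamma>)"
  proof (rule sum.reindex_bij_witness[where i = "dec j" and j = "inc j"])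
    fix \<gamma> assume "\<gamma> \<in> {\<gamma> \<in> tuples_upto N (s + j). \<gamma> j \<noteq> 0}"
    then show "dec j \<gamma> \<in> tuples_upto N s"
      using weight_upto_dec[of j N \<gamma>] assms by (auto simp: tuples_upto_def dec_def)
  qed (use assms in \<open>auto simp: tuples_upto_def weight_upto_inc dec_inc inc_dec\<close>)
  also have "\<dots> = (\<Sum>\<gamma>\<in>tuples_upto N (s + j). if \<gamma> j = 0 then 0 else h (dec j \<gamma>) \<gamma>)"
    by (subst sum.inter_filter[OF finite_tuples_upto]) (auto intro: sum.cong)
  finally show ?thesis .
qed

text \<open>Moving one unit from \<open>j\<close> to \<open>j + 1\<close> raises the weight by 1.
  The factor \<open>\<alpha> j\<close> discards the tuples with no unit to move, and in terms of the
  image it becomes \<open>\<gamma> j + 1\<close>, the factor in the stated recurrence.\<close>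

lemma sum_tuples_upto_shift:
  fixes h :: "(nat \<Rightarrow> nat) \<Rightarrow> (nat \<Rightarrow> nat) \<Rightarrow> complex"
  assumes "1 \<le> j" "j < N"
  shows "(\<Sum>\<alpha>\<in>tuples_upto N s. of_nat (\<alpha> j) * h \<alpha> (inc (j + 1) (dec j \<alpha>))) =
         (\<Sum>\<gamma>\<in>tuples_upto N (s + 1). if \<gamma> (j + 1) = 0 then 0
            else (of_nat (\<gamma> j) + 1) * h (inc j (dec (j + 1) \<gamma>)) \<gamma>)"
proof -
  have j: "j \<in> {1..N}" "j + 1 \<in> {1..N}" using assms by auto
  have w: "weight_upto N (inc (j + 1) (dec j \<alpha>)) = weight_upto N \<alpha> + 1" if "\<alpha> j > 0" for \<alpha>
    using weight_upto_inc[OF j(2), of "dec j \<alpha>"] weight_upto_dec[of j N \<alpha>] j(1) that by simp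
  have w': "weight_upto N (inc j (dec (j + 1) \<alpha>)) + 1 = weight_upto N \<alpha>" if "\<alpha> (j + 1) > 0" for \<alpha>
    using weight_upto_inc[OF j(1), of "dec (j + 1) \<alpha>"] weight_upto_dec[of "j + 1" N \<alpha>] j(2) that by simp
  have "(\<Sum>\<alpha>\<in>tuples_upto N s. of_nat (\<alpha> j) * h \<alpha> (inc (j + 1) (dec j \<alpha>))) =
        (\<Sum>\<alpha>\<in>{\<alpha> \<in> tuples_upto N s. \<alpha> j \<noteq> 0}. of_nat (\<alpha> j) * h \<alpha> (inc (j + 1) (dec j \<alpha>)))"
    by (rule sum.mono_neutral_right) (auto simp: finite_tuples_upto)
  also have "\<dots> = (\<Sum>\<gamma>\<in>{\<gamma> \<in> tuples_upto N (s + 1). \<gamma> (j + 1) \<noteq> 0}.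
      (of_nat (\<gamma> j) + 1) * h (inc j (dec (j + 1) \<gamma>)) \<gamma>)"
  proof (rule sum.reindex_bij_witness[where i = "\<lambda>\<gamma>. inc j (dec (j + 1) \<gamma>)"
        and j = "\<lambda>\<alpha>. inc (j + 1) (dec j \<alpha>)"])
    fix \<gamma> assume "\<gamma> \<in> {\<gamma> \<in> tuples_upto N (s + 1). \<gamma> (j + 1) \<noteq> 0}"
    then show "inc j (dec (j + 1) \<gamma>) \<in> {\<alpha> \<in> tuples_upto N s. \<alpha> j \<noteq> 0}"
      using w'[of \<gamma>] assms by (auto simp: tuples_upto_def)
  next
    fix \<alpha> assume "\<alpha> \<in> {\<alpha> \<in> tuples_upto N s. \<alpha> j \<noteq> 0}"
    then show "inc (j + 1) (dec j \<alpha>) \<in> {\<gamma> \<in> tuples_upto N (s + 1). \<gamma> (j + 1) \<noteq> 0}"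
      using w[of \<alpha>] assms by (auto simp: tuples_upto_def)
  qed (use assms in \<open>auto simp: dec_inc inc_dec simp flip: of_nat_Suc\<close>)
  also have "\<dots> = (\<Sum>\<gamma>\<in>tuples_upto N (s + 1). if \<gamma> (j + 1) = 0 then 0
            else (of_nat (\<gamma> j) + 1) * h (inc j (dec (j + 1) \<gamma>)) \<gamma>)"
    by (subst sum.inter_filter[OF finite_tuples_upto]) (auto intro: sum.cong)
  finally show ?thesis .
qed

section \<open>The coefficients and their recurrence\<close>

text \<open>The start \<open>n = 0\<close> stands for the identity operator.\<close>
primrec coeff_C :: coeffs where
  "coeff_C s m 0 \<gamma> = (if s = 0 \<and> \<gamma> \<in> tuples m 0 then 1 else 0)"
| "coeff_C s m (Suc n) \<gamma> = coeff_C s m n \<gamma> +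
     (if s = 0 \<or> \<gamma> \<notin> tuples m s then 0
      else (of_nat n + 1 - of_nat m) *
             (if \<gamma> 1 = 0 then 0 else coeff_C (s - 1) (m - 1) n (dec 1 \<gamma>)) +
           (\<Sum>j=1..s-1. if \<gamma> (j + 1) = 0 then 0
              else (of_nat (\<gamma> j) + 1) * coeff_C (s - 1) m n (inc j (dec (j + 1) \<gamma>))))"

lemma coeff_C_outside: "\<gamma> \<notin> tuples m s \<Longrightarrow> coeff_C s m n \<gamma> = 0"
  by (induction n) auto

lemma coeff_C_Suc:
  assumes "\<gamma> \<in> tuples m (s + 1)"
  shows "coeff_C (s + 1) m (n + 1) \<gamma> = coeff_C (s + 1) m n \<gamma> +
     ((of_nat n + 1 - of_nat m) * (if \<gamma> 1 = 0 then 0 else coeff_C s (m - 1) n (dec 1 \<gamma>)) +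
      (\<Sum>j=1..s. if \<gamma> (j + 1) = 0 then 0
              else (of_nat (\<gamma> j) + 1) * coeff_C s m n (inc j (dec (j + 1) \<gamma>))))"
  using assms by (simp cong: if_cong)

lemma coeff_C_weight_zero: "coeff_C 0 0 n (\<lambda>_. 0) = 1"
  by (induction n) (auto simp: tuples_zero)

text \<open>Weight \<open>s\<close> belongs to the derivative of order \<open>n - s\<close>, and a
  positive power of \<open>A\<close> has no term of order 0. In the induction, \<open>n\<close> and
  the weight drop together.\<close>

lemma coeff_C_eq_0:
  assumes "s > 0" "n \<le> s"
  shows "coeff_C s m n \<gamma> = 0"
  using assms
proof (induction n arbitrary: s m \<gamma>)
  case (Suc n)
  show ?case
  proof (cases "\<gamma> \<in> tuples m s")
    case True
    obtain s' where s: "s = s' + 1" using Suc.prems(1) by (cases s) auto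
    have IH: "coeff_C s m n \<gamma> = 0" using Suc by simp
    show ?thesis
    proof (cases "s' = 0")
      case True
      with \<open>\<gamma> \<in> tuples m s\<close> tuples_bounds[of \<gamma> m s] s have "m = 1" by auto
      \<comment> \<open>The weight-zero coefficient may be 1 here, but \<open>n = 0\<close> and
        \<open>m = 1\<close> make its factor \<open>n + 1 - m\<close> zero.\<close>
      with IH True Suc.prems s show ?thesis by simp
    next
      case False
      with Suc have "coeff_C s' m' n \<gamma>' = 0" for m' \<gamma>' using s by simp
      then show ?thesis using IH by (simp add: s cong: if_cong)
    qed
  qed (rule coeff_C_outside)
qed auto

text \<open>The one-step recurrence telescopes, starting from the value 0 at
  \<open>n = s + 1\<close>, where the sum over \<open>t\<close> is empty.\<close>

lemma coeff_C_unroll: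
  assumes "\<gamma> \<in> tuples m (s + 1)" "s \<le> k"
  shows "coeff_C (s + 1) m (k + 1) \<gamma> = (\<Sum>t=s+1..k.
     ((of_nat t + 1 - of_nat m) * (if \<gamma> 1 = 0 then 0 else coeff_C s (m - 1) t (dec 1 \<gamma>)) +
      (\<Sum>j=1..s. if \<gamma> (j + 1) = 0 then 0
              else (of_nat (\<gamma> j) + 1) * coeff_C s m t (inc j (dec (j + 1) \<gamma>)))))"
  using assms(2)
proof (induction k rule: dec_induct)
  case base
  show ?case using coeff_C_eq_0[of "s + 1" "s + 1"] by simp
next
  case (step k)
  have "{s+1..Suc k} = insert (k + 1) {s+1..k}" using step by auto
  then show ?case
    using coeff_C_Suc[OF assms(1), of "k + 1"] step.IH by (simp del: coeff_C.simps cong: if_cong)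
qed

section \<open>Differential monomials and their derivatives\<close>

text \<open>\<open>monomial v N n \<alpha>\<close> is the differential monomial of total degree \<open>n\<close> in \<open>v 0 = u\<close> and
  \<open>v i = u\<^sup>(\<^sup>i\<^sup>)\<close>.\<close>
definition monomial :: "(nat \<Rightarrow> 'a \<Rightarrow> complex) \<Rightarrow> nat \<Rightarrow> nat \<Rightarrow> (nat \<Rightarrow> nat) \<Rightarrow> 'a \<Rightarrow> complex" where
  "monomial v N n \<alpha> z = v 0 z ^ (n - size_upto N \<alpha>) * (\<Prod>i=1..N. v i z ^ \<alpha> i)"

lemma prod_power_inc:
  fixes x :: "nat \<Rightarrow> 'a::comm_monoid_mult"
  assumes "j \<in> {1..N}"
  shows "(\<Prod>i=1..N. x i ^ inc j \<alpha> i) = x j * (\<Prod>i=1..N. x i ^ \<alpha> i)"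
  using assms by (simp add: prod.remove[of _ j] mult.assoc)

text \<open>This is the product rule. After multiplication by \<open>v 0 z\<close> every term is a
  multiple of a monomial of degree \<open>n + 1\<close>. The bound \<open>s \<le> n\<close> makes
  the exponent \<open>n - size_upto N \<alpha>\<close> a true difference.\<close>

lemma monomial_derivative:
  assumes v: "\<And>i. (v i has_field_derivative v (i + 1) z) (at z)"
    and \<alpha>: "\<alpha> \<in> tuples_upto N s" and s: "s < N" "s \<le> n"
  obtains d where "(monomial v N n \<alpha> has_field_derivative d) (at z)"
    "v 0 z * d = (of_nat n - of_nat (size_upto N \<alpha>)) * monomial v N (n + 1) (inc 1 \<alpha>) z +
       (\<Sum>j=1..<N. of_nat (\<alpha> j) * monomial v N (n + 1) (inc (j + 1) (dec j \<alpha>)) z)"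
proof -
  let ?p = "\<lambda>\<alpha>. \<Prod>i=1..N. v i z ^ \<alpha> i"
  define q where "q = n - size_upto N \<alpha>"
  have size: "size_upto N \<alpha> \<le> n"
    using size_le_weight[of N \<alpha>] \<alpha> s by (simp add: tuples_upto_def)
  define D where "D = (\<Sum>j=1..N. (of_nat (\<alpha> j) * (v j z ^ (\<alpha> j - 1) * v (j + 1) z)) *
      (\<Prod>i\<in>{1..N}-{j}. v i z ^ \<alpha> i))"
  have D: "((\<lambda>w. \<Prod>i=1..N. v i w ^ \<alpha> i) has_field_derivative D) (at z)"
    unfolding D_def
    by (rule has_field_derivative_prod) (auto intro!: derivative_eq_intros v)
  \<comment> \<open>Because of \<open>s < N\<close>, no unit has to move from \<open>N\<close> to
    \<open>N + 1\<close>, out of the range of the tuples.\<close>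
  have N: "\<alpha> N = 0" using tuples_upto_vanish[OF \<alpha>] s by simp
  have D_eq: "D = (\<Sum>j=1..<N. of_nat (\<alpha> j) * ?p (inc (j + 1) (dec j \<alpha>)))"
  proof -
    have "D = (\<Sum>j=1..<N. (of_nat (\<alpha> j) * (v j z ^ (\<alpha> j - 1) * v (j + 1) z)) *
      (\<Prod>i\<in>{1..N}-{j}. v i z ^ \<alpha> i))"
      unfolding D_def by (rule sum.mono_neutral_right) (use N in \<open>auto simp: not_less dest: le_antisym\<close>)
    also have "\<dots> = (\<Sum>j=1..<N. of_nat (\<alpha> j) * ?p (inc (j + 1) (dec j \<alpha>)))"
    proof (rule sum.cong)
      fix j assume j: "j \<in> {1..<N}"
      then have "?p (inc (j + 1) (dec j \<alpha>)) = v (j + 1) z * ?p (dec j \<alpha>)"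
        by (intro prod_power_inc) auto
      also have "?p (dec j \<alpha>) = v j z ^ (\<alpha> j - 1) * (\<Prod>i\<in>{1..N}-{j}. v i z ^ \<alpha> i)"
        using j by (subst prod.remove[of _ j]) auto
      finally show "(of_nat (\<alpha> j) * (v j z ^ (\<alpha> j - 1) * v (j + 1) z)) *
          (\<Prod>i\<in>{1..N}-{j}. v i z ^ \<alpha> i) = of_nat (\<alpha> j) * ?p (inc (j + 1) (dec j \<alpha>))"
        by (simp add: mult_ac)
    qed simp
    finally show ?thesis .
  qed
  have "(monomial v N n \<alpha> has_field_derivative
      (of_nat q * (v 0 z ^ (q - 1) * v 1 z)) * ?p \<alpha> + D * v 0 z ^ q) (at z)"
    unfolding monomial_def q_def[symmetric]
    by (rule DERIV_mult[OF _ D]) (use v[of 0] in \<open>auto intro!: derivative_eq_intros\<close>)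
  moreover have "v 0 z * ((of_nat q * (v 0 z ^ (q - 1) * v 1 z)) * ?p \<alpha> + D * v 0 z ^ q) =
      (of_nat n - of_nat (size_upto N \<alpha>)) * monomial v N (n + 1) (inc 1 \<alpha>) z +
       (\<Sum>j=1..<N. of_nat (\<alpha> j) * monomial v N (n + 1) (inc (j + 1) (dec j \<alpha>)) z)"
  proof -
    have "(of_nat n - of_nat (size_upto N \<alpha>)) * monomial v N (n + 1) (inc 1 \<alpha>) z =
        of_nat q * (v 0 z ^ q * v 1 z * ?p \<alpha>)"
      using s size prod_power_inc[of 1 N "\<lambda>i. v i z" \<alpha>]
      by (simp add: monomial_def size_upto_inc q_def of_nat_diff)
    \<comment> \<open>For \<open>q = 0\<close> the truncated exponent \<open>q - 1\<close> does no
      harm, since the factor \<open>of_nat q\<close> is 0.\<close>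
    moreover have "v 0 z * (of_nat q * (v 0 z ^ (q - 1) * v 1 z)) * ?p \<alpha> =
        of_nat q * (v 0 z ^ q * v 1 z * ?p \<alpha>)"
      by (cases q) (auto simp: mult_ac)
    moreover have "of_nat (\<alpha> j) * monomial v N (n + 1) (inc (j + 1) (dec j \<alpha>)) z =
        v 0 z ^ (q + 1) * (of_nat (\<alpha> j) * ?p (inc (j + 1) (dec j \<alpha>)))" if "j \<in> {1..<N}" for j
    \<comment> \<open>If \<open>\<alpha> j = 0\<close>, the truncated \<open>dec j\<close> changes
      nothing and the size is not preserved, but both sides are 0.\<close>
    proof (cases "\<alpha> j = 0")
      case False
      then have "size_upto N (inc (j + 1) (dec j \<alpha>)) = size_upto N \<alpha>"
        using that size_upto_dec[of j N \<alpha>] by (simp add: size_upto_inc)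
      then show ?thesis using size by (simp add: monomial_def q_def Suc_diff_le)
    qed simp
    then have "(\<Sum>j=1..<N. of_nat (\<alpha> j) * monomial v N (n + 1) (inc (j + 1) (dec j \<alpha>)) z) =
        v 0 z ^ (q + 1) * D"
      unfolding D_eq sum_distrib_left by (intro sum.cong) auto
    ultimately show ?thesis by (simp add: algebra_simps)
  qed
  ultimately show ?thesis by (rule that)
qed

section \<open>The coefficient functions of the expansion\<close>

text \<open>With \<open>v i\<close> the derivatives of \<open>u\<close>, this is the coefficient of
  the derivative of order \<open>n - s\<close>. One sum over all tuples of weight \<open>s\<close>
  replaces the double sum over \<open>m\<close> and tuples, and \<open>s = 0\<close> and
  \<open>s = n\<close> need no separate treatment.\<close>

definition Q :: "(nat \<Rightarrow> 'a \<Rightarrow> complex) \<Rightarrow> nat \<Rightarrow> nat \<Rightarrow> nat \<Rightarrow> 'a \<Rightarrow> complex" where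
  "Q v N n s z = (\<Sum>\<alpha>\<in>tuples_upto N s. coeff_C s (size_upto N \<alpha>) n \<alpha> * monomial v N n \<alpha> z)"

text \<open>The recurrence \<open>P_(n+1)^(n-s) = u P_n^(n-s-1) + u (P_n^(n-s))'\<close>, obtained
  by comparing coefficients of each monomial with the recurrence for \<open>coeff_C\<close>.\<close>

lemma Q_derivative:
  assumes v: "\<And>i. (v i has_field_derivative v (i + 1) z) (at z)"
    and s: "s < N" "s \<le> n"
  obtains d where "(Q v N n s has_field_derivative d) (at z)"
    "Q v N (n + 1) (s + 1) z = v 0 z * Q v N n (s + 1) z + v 0 z * d"
proof -
  let ?M = "\<lambda>\<gamma>. monomial v N (n + 1) \<gamma> z"
  let ?c = "\<lambda>\<alpha>. coeff_C s (size_upto N \<alpha>) n \<alpha>"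
  have "\<forall>\<alpha>\<in>tuples_upto N s. \<exists>d. (monomial v N n \<alpha> has_field_derivative d) (at z) \<and>
    v 0 z * d = (of_nat n - of_nat (size_upto N \<alpha>)) * ?M (inc 1 \<alpha>) +
       (\<Sum>j=1..<N. of_nat (\<alpha> j) * ?M (inc (j + 1) (dec j \<alpha>)))"
    using monomial_derivative[of v z, OF v _ s] by blast
  from bchoice[OF this] obtain d where d: "\<And>\<alpha>. \<alpha> \<in> tuples_upto N s \<Longrightarrow>
      (monomial v N n \<alpha> has_field_derivative d \<alpha>) (at z)"
    "\<And>\<alpha>. \<alpha> \<in> tuples_upto N s \<Longrightarrow>
    v 0 z * d \<alpha> = (of_nat n - of_nat (size_upto N \<alpha>)) * ?M (inc 1 \<alpha>) +
       (\<Sum>j=1..<N. of_nat (\<alpha> j) * ?M (inc (j + 1) (dec j \<alpha>)))"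
    by blast
  let ?d = "\<Sum>\<alpha>\<in>tuples_upto N s. ?c \<alpha> * d \<alpha>"
  have "(Q v N n s has_field_derivative ?d) (at z)"
    unfolding Q_def by (intro DERIV_sum DERIV_cmult d(1))
  moreover have "Q v N (n + 1) (s + 1) z = v 0 z * Q v N n (s + 1) z + v 0 z * ?d"
  proof -
    \<comment> \<open>\<open>a \<gamma>\<close> collects what reaches \<open>\<gamma>\<close> by
      differentiating the power of \<open>u\<close>, and \<open>b j \<gamma>\<close> what reaches it
      by differentiating a factor \<open>v j\<close>.\<close>
    define a where "a \<gamma> = (if \<gamma> 1 = 0 then 0 else
      ?c (dec 1 \<gamma>) * (of_nat n - of_nat (size_upto N (dec 1 \<gamma>))) * ?M \<gamma>)" for \<gamma>
    define b where "b j \<gamma> = (if \<gamma> (j + 1) = 0 then 0 else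
      (of_nat (\<gamma> j) + 1) * (?c (inc j (dec (j + 1) \<gamma>)) * ?M \<gamma>))" for j \<gamma>
    have "v 0 z * ?d = (\<Sum>\<alpha>\<in>tuples_upto N s. ?c \<alpha> * (v 0 z * d \<alpha>))"
      by (simp add: sum_distrib_left mult_ac)
    also have "\<dots> = (\<Sum>\<alpha>\<in>tuples_upto N s.
        ?c \<alpha> * (of_nat n - of_nat (size_upto N \<alpha>)) * ?M (inc 1 \<alpha>) +
        (\<Sum>j=1..<N. of_nat (\<alpha> j) * (?c \<alpha> * ?M (inc (j + 1) (dec j \<alpha>)))))"
      by (rule sum.cong[OF refl], subst d(2)) (simp_all add: distrib_left sum_distrib_left mult_ac)
    also have "\<dots> = (\<Sum>\<alpha>\<in>tuples_upto N s.
        ?c \<alpha> * (of_nat n - of_nat (size_upto N \<alpha>)) * ?M (inc 1 \<alpha>)) +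
        (\<Sum>j=1..<N. \<Sum>\<alpha>\<in>tuples_upto N s. of_nat (\<alpha> j) * (?c \<alpha> * ?M (inc (j + 1) (dec j \<alpha>))))"
      unfolding sum.distrib by (rule arg_cong[OF sum.swap])
    also have "(\<Sum>\<alpha>\<in>tuples_upto N s.
        ?c \<alpha> * (of_nat n - of_nat (size_upto N \<alpha>)) * ?M (inc 1 \<alpha>)) =
        (\<Sum>\<gamma>\<in>tuples_upto N (s + 1). a \<gamma>)"
      unfolding a_def
      by (rule sum_tuples_upto_inc[of 1 N "\<lambda>\<alpha> \<gamma>. ?c \<alpha> * (of_nat n - of_nat (size_upto N \<alpha>)) * ?M \<gamma>"])
        (use s in auto)
    also have "(\<Sum>j=1..<N. \<Sum>\<alpha>\<in>tuples_upto N s. of_nat (\<alpha> j) * (?c \<alpha> * ?M (inc (j + 1) (dec j \<alpha>)))) =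
        (\<Sum>j=1..<N. \<Sum>\<gamma>\<in>tuples_upto N (s + 1). b j \<gamma>)"
      unfolding b_def
      by (intro sum.cong refl sum_tuples_upto_shift[where h = "\<lambda>\<alpha> \<gamma>. ?c \<alpha> * ?M \<gamma>"]) auto
    also have "\<dots> = (\<Sum>\<gamma>\<in>tuples_upto N (s + 1). \<Sum>j=1..<N. b j \<gamma>)"
      by (rule sum.swap)
    finally have d_eq: "v 0 z * ?d = (\<Sum>\<gamma>\<in>tuples_upto N (s + 1). a \<gamma> + (\<Sum>j=1..<N. b j \<gamma>))"
      by (simp add: sum.distrib)
    have "coeff_C (s + 1) (size_upto N \<gamma>) (n + 1) \<gamma> * ?M \<gamma> =
        v 0 z * (coeff_C (s + 1) (size_upto N \<gamma>) n \<gamma> * monomial v N n \<gamma> z) +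
        (a \<gamma> + (\<Sum>j=1..<N. b j \<gamma>))" if \<gamma>: "\<gamma> \<in> tuples_upto N (s + 1)" for \<gamma>
    proof -
      define m where "m = size_upto N \<gamma>"
      have tup: "\<gamma> \<in> tuples m (s + 1)" using \<gamma> s tuples_iff_upto[of "s + 1" N] by (simp add: m_def)
      have ms: "m \<le> s + 1" using tuples_bounds[OF tup] by simp
      have "coeff_C (s + 1) m n \<gamma> * ?M \<gamma> = v 0 z * (coeff_C (s + 1) m n \<gamma> * monomial v N n \<gamma> z)"
      \<comment> \<open>Only for \<open>n = s\<close> can \<open>m\<close> exceed \<open>n\<close>,
        so that \<open>n - m\<close> is truncated; the coefficient is then 0.\<close>
      proof (cases "n = s")
        case True
        then show ?thesis using coeff_C_eq_0[of "s + 1" n m \<gamma>] by simp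
      next
        case False
        then have "n + 1 - m = (n - m) + 1" using ms s by simp
        then show ?thesis by (simp add: monomial_def m_def[symmetric])
      qed
      moreover have "(of_nat n + 1 - of_nat m) *
          (if \<gamma> 1 = 0 then 0 else coeff_C s (m - 1) n (dec 1 \<gamma>)) * ?M \<gamma> = a \<gamma>"
      proof (cases "\<gamma> 1 = 0")
        case False
        then have "m = size_upto N (dec 1 \<gamma>) + 1"
          using size_upto_dec[of 1 N \<gamma>] s by (simp add: m_def)
        then show ?thesis using False by (simp add: a_def)
      qed (simp add: a_def)
      moreover have "(\<Sum>j=1..s. if \<gamma> (j + 1) = 0 then 0
              else (of_nat (\<gamma> j) + 1) * coeff_C s m n (inc j (dec (j + 1) \<gamma>))) * ?M \<gamma> =
          (\<Sum>j=1..<N. b j \<gamma>)"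
      proof -
        \<comment> \<open>For \<open>j > s\<close> the entry of \<open>\<gamma>\<close> at
          \<open>j + 1\<close> lies beyond its weight \<open>s + 1\<close> and vanishes.\<close>
        have "(\<Sum>j=1..<N. b j \<gamma>) = (\<Sum>j=1..s. b j \<gamma>)"
          by (rule sum.mono_neutral_right) (use s tuples_upto_vanish[OF \<gamma>] in \<open>auto simp: b_def\<close>)
        also have "\<dots> = (\<Sum>j=1..s. (if \<gamma> (j + 1) = 0 then 0
              else (of_nat (\<gamma> j) + 1) * coeff_C s m n (inc j (dec (j + 1) \<gamma>))) * ?M \<gamma>)"
        proof (rule sum.cong)
          fix j assume j: "j \<in> {1..s}"
          have "size_upto N (inc j (dec (j + 1) \<gamma>)) = m" if "\<gamma> (j + 1) > 0"
            using that j s size_upto_dec[of "j + 1" N \<gamma>] by (simp add: size_upto_inc m_def)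
          then show "b j \<gamma> = (if \<gamma> (j + 1) = 0 then 0
              else (of_nat (\<gamma> j) + 1) * coeff_C s m n (inc j (dec (j + 1) \<gamma>))) * ?M \<gamma>"
            by (simp add: b_def)
        qed simp
        finally show ?thesis by (simp add: sum_distrib_right)
      qed
      ultimately show ?thesis
        unfolding m_def[symmetric] coeff_C_Suc[OF tup] distrib_right by (simp only: add.assoc)
    qed
    then show ?thesis
      unfolding d_eq by (simp add: Q_def sum_distrib_left sum.distrib del: coeff_C.simps)
  qed
  ultimately show ?thesis by (rule that)
qed

lemma Q_weight_zero: "Q v N n 0 z = v 0 z ^ n"
proof -
  have "tuples_upto N 0 = {\<lambda>_. 0}"
  proof (intro equalityI subsetI)
    fix \<alpha> assume \<alpha>: "\<alpha> \<in> tuples_upto N 0"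
    then have "\<alpha> \<in> tuples (size_upto N \<alpha>) 0" using tuples_iff_upto[of 0 N] by simp
    then show "\<alpha> \<in> {\<lambda>_. 0}" by (simp add: tuples_zero)
  qed (auto simp: tuples_upto_def weight_upto_def)
  then show ?thesis
    by (simp add: Q_def monomial_def size_upto_def coeff_C_weight_zero)
qed

lemma Q_eq_0: "0 < s \<Longrightarrow> n \<le> s \<Longrightarrow> Q v N n s z = 0"
  by (simp add: Q_def coeff_C_eq_0)

text \<open>Grouping the tuples of weight \<open>s\<close> by their size, which lies in
  \<open>{1..s}\<close> for \<open>s > 0\<close>, gives the double sum in \<open>P\<close>.\<close>

lemma P_eq_Q:
  assumes "s < n" "s \<le> N"
  shows "P coeff_C n (n - s) u z = Q (\<lambda>i. (deriv ^^ i) u) N n s z"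
proof (cases "s = 0")
  case True
  then show ?thesis by (simp add: P_def Q_weight_zero)
next
  case False
  let ?v = "\<lambda>i. (deriv ^^ i) u"
  have part: "{\<alpha> \<in> tuples_upto N s. size_upto N \<alpha> = m} = tuples m s" for m
    using tuples_iff_upto[OF assms(2)] by auto
  have "P coeff_C n (n - s) u z = (\<Sum>m=1..s. u z ^ (n - m) *
         (\<Sum>\<alpha>\<in>tuples m s. coeff_C s m n \<alpha> * (\<Prod>i=1..s. (?v i z) ^ \<alpha> i)))"
    using False assms by (simp add: P_def)
  also have "\<dots> = (\<Sum>m=1..s. \<Sum>\<alpha>\<in>{\<alpha> \<in> tuples_upto N s. size_upto N \<alpha> = m}.
      coeff_C s (size_upto N \<alpha>) n \<alpha> * monomial ?v N n \<alpha> z)"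
    unfolding sum_distrib_left
  proof (intro sum.cong)
    fix m \<alpha> assume "\<alpha> \<in> {\<alpha> \<in> tuples_upto N s. size_upto N \<alpha> = m}"
    then have \<alpha>: "size_upto N \<alpha> = m" "\<And>i. s < i \<Longrightarrow> \<alpha> i = 0"
      using tuples_upto_vanish by auto
    have "(\<Prod>i=1..N. ?v i z ^ \<alpha> i) = (\<Prod>i=1..s. ?v i z ^ \<alpha> i)"
      by (rule prod.mono_neutral_right) (use \<alpha> assms in auto)
    then show "u z ^ (n - m) * (coeff_C s m n \<alpha> * (\<Prod>i=1..s. (?v i z) ^ \<alpha> i)) =
        coeff_C s (size_upto N \<alpha>) n \<alpha> * monomial ?v N n \<alpha> z"
      by (simp add: monomial_def \<alpha>(1) mult_ac)
  qed (simp_all only: part)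
  also have "\<dots> = Q ?v N n s z"
    unfolding Q_def
  proof (rule sum.group)
    show "size_upto N ` tuples_upto N s \<subseteq> {1..s}"
    proof safe
      fix \<alpha> assume "\<alpha> \<in> tuples_upto N s"
      then have "\<alpha> \<in> tuples (size_upto N \<alpha>) s" using tuples_iff_upto[OF assms(2)] by simp
      from tuples_bounds[OF this] False show "size_upto N \<alpha> \<in> {1..s}" by simp
    qed
  qed (simp_all add: finite_tuples_upto)
  finally show ?thesis .
qed

section \<open>Expansion of the powers of the operator\<close>

text \<open>Induction on \<open>n\<close>, with one length \<open>N\<close> fixed throughout so that
  \<open>Q_derivative\<close> applies at every step. The formula is proved on the whole open set
  because the next step differentiates it.\<close>

lemma A_op_power:
  assumes S: "open S" "u holomorphic_on S" "f holomorphic_on S"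
    and "n \<le> N" "z \<in> S"
  shows "(A_op u ^^ n) f z = (\<Sum>s\<le>n. Q (\<lambda>i. (deriv ^^ i) u) N n s z * (deriv ^^ (n - s)) f z)"
  using assms(4,5)
proof (induction n arbitrary: z)
  case 0
  then show ?case by (simp add: Q_weight_zero)
next
  case (Suc n)
  let ?v = "\<lambda>i. (deriv ^^ i) u"
  let ?g = "\<lambda>i. (deriv ^^ i) f"
  have der: "((deriv ^^ i) h has_field_derivative (deriv ^^ (i + 1)) h z) (at z)"
    if "h holomorphic_on S" for h i
    using holomorphic_derivI[OF holomorphic_higher_deriv[OF that S(1)] S(1) Suc.prems(2)] by simp
  have "\<exists>d. (Q ?v N n s has_field_derivative d) (at z) \<and>
    Q ?v N (n + 1) (s + 1) z = u z * Q ?v N n (s + 1) z + u z * d" if "s \<le> n" for s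
  proof -
    have "s < N" using that Suc.prems by simp
    from Q_derivative[of ?v z, OF der[OF S(2)] this that] show ?thesis by auto
  qed
  then obtain d where d: "\<And>s. s \<le> n \<Longrightarrow> (Q ?v N n s has_field_derivative d s) (at z)"
    "\<And>s. s \<le> n \<Longrightarrow> Q ?v N (n + 1) (s + 1) z = u z * Q ?v N n (s + 1) z + u z * d s"
    by metis
  have "((\<lambda>w. \<Sum>s\<le>n. Q ?v N n s w * ?g (n - s) w) has_field_derivative
      (\<Sum>s\<le>n. d s * ?g (n - s) z + ?g (n - s + 1) z * Q ?v N n s z)) (at z)"
    by (intro DERIV_sum DERIV_mult d(1) der[OF S(3)]) auto
  then have "((A_op u ^^ n) f has_field_derivative
      (\<Sum>s\<le>n. d s * ?g (n - s) z + ?g (n - s + 1) z * Q ?v N n s z)) (at z)"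
    by (rule has_field_derivative_transform_within_open[OF _ S(1) Suc.prems(2)])
      (use Suc in auto)
  then have "(A_op u ^^ Suc n) f z = u z * (\<Sum>s\<le>n. d s * ?g (n - s) z + ?g (n - s + 1) z * Q ?v N n s z)"
    by (simp add: A_op_def DERIV_imp_deriv)
  also have "\<dots> = (\<Sum>s\<le>n. u z * Q ?v N n s z * ?g (Suc n - s) z) + (\<Sum>s\<le>n. u z * d s * ?g (n - s) z)"
    by (simp add: sum_distrib_left distrib_left sum.distrib Suc_diff_le mult_ac)
  \<comment> \<open>The added term \<open>s = Suc n\<close> is 0; with it, splitting off
    \<open>s = 0\<close> leaves a sum that matches the derivative terms index by index.\<close>
  also have "(\<Sum>s\<le>n. u z * Q ?v N n s z * ?g (Suc n - s) z) =
      (\<Sum>s\<le>Suc n. u z * Q ?v N n s z * ?g (Suc n - s) z)"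
    by (simp add: Q_eq_0)
  also have "\<dots> = u z * Q ?v N n 0 z * ?g (Suc n) z +
      (\<Sum>s\<le>n. u z * Q ?v N n (Suc s) z * ?g (n - s) z)"
    by (subst sum.atMost_Suc_shift) simp
  also have "\<dots> + (\<Sum>s\<le>n. u z * d s * ?g (n - s) z) = Q ?v N (Suc n) 0 z * ?g (Suc n) z +
      (\<Sum>s\<le>n. Q ?v N (Suc n) (Suc s) z * ?g (n - s) z)"
    using d(2) by (simp add: Q_weight_zero add.assoc distrib_right flip: sum.distrib)
  also have "\<dots> = (\<Sum>s\<le>Suc n. Q ?v N (Suc n) s z * ?g (Suc n - s) z)"
    by (subst sum.atMost_Suc_shift) simp
  finally show ?case .
qed

text \<open>Analyticity at \<open>z\<close> gives an open neighbourhood on which both functions are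
  holomorphic. The term of order 0 vanishes, and the remaining sum is reversed.\<close>

lemma operator_expansion_coeff_C: "operator_expansion coeff_C u k"
  unfolding operator_expansion_def
proof (intro allI impI)
  fix f z assume "u analytic_on {z} \<and> f analytic_on {z}"
  then obtain S where S: "open S" "z \<in> S" "u holomorphic_on S" "f holomorphic_on S"
    using analytic_at_two[of u z f] by blast
  let ?v = "\<lambda>i. (deriv ^^ i) u"
  have "(A_op u ^^ (k + 1)) f z = (\<Sum>s\<le>k + 1. Q ?v (k + 1) (k + 1) s z * (deriv ^^ (k + 1 - s)) f z)"
    using A_op_power[OF S(1,3,4) order_refl S(2)] .
  also have "\<dots> = (\<Sum>s\<le>k. Q ?v (k + 1) (k + 1) s z * (deriv ^^ (k + 1 - s)) f z)"
    by (simp add: Q_eq_0)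
  also have "\<dots> = (\<Sum>s\<le>k. P coeff_C (k + 1) (k + 1 - s) u z * (deriv ^^ (k + 1 - s)) f z)"
    by (intro sum.cong refl) (simp add: P_eq_Q[of _ "Suc k" "Suc k"])
  also have "\<dots> = (\<Sum>s=1..k+1. P coeff_C (k + 1) s u z * (deriv ^^ s) f z)"
    by (rule sum.reindex_bij_witness[where i = "\<lambda>s. k + 1 - s" and j = "\<lambda>s. k + 1 - s"]) auto
  finally show "(A_op u ^^ (k + 1)) f z = (\<Sum>s=1..k+1. P coeff_C (k + 1) s u z * (deriv ^^ s) f z)" .
qed

section \<open>Symbols with shifted indices, and the three relations\<close>

text \<open>The lowered index is negative exactly when \<open>\<gamma> j = 0\<close>, so the
  convention for symbols agrees with the case distinction in \<open>coeff_C\<close>.\<close>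

lemma symb_dec:
  "symb C s m n ((\<lambda>i. int (\<gamma> i))(j := int (\<gamma> j) - 1)) =
    (if \<gamma> j = 0 then 0 else C s m n (dec j \<gamma>))"
proof -
  have "(\<lambda>i. nat (((\<lambda>i. int (\<gamma> i))(j := int (\<gamma> j) - 1)) i)) = dec j \<gamma>"
    by (rule ext) (auto simp: dec_def)
  then show ?thesis by (auto simp: symb_def)
qed

lemma symb_shift:
  "symb C s m n ((\<lambda>i. int (\<gamma> i))(j := int (\<gamma> j) + 1, j + 1 := int (\<gamma> (j + 1)) - 1)) =
    (if \<gamma> (j + 1) = 0 then 0 else C s m n (inc j (dec (j + 1) \<gamma>)))"
proof -
  have "(\<lambda>i. int (\<gamma> i))(j := int (\<gamma> j) + 1, j + 1 := int (\<gamma> (j + 1)) - 1) =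
      (\<lambda>i. int (inc j \<gamma> i))(j + 1 := int (inc j \<gamma> (j + 1)) - 1)"
    by (auto simp: inc_def)
  moreover have "dec (j + 1) (inc j \<gamma>) = inc j (dec (j + 1) \<gamma>)"
    by (auto simp: inc_def dec_def)
  ultimately show ?thesis using symb_dec[of C s m n "inc j \<gamma>" "j + 1"] by simp
qed

theorem theorem2p1:
  "\<exists>C :: coeffs.
     (\<forall>u k. u meromorphic_on UNIV \<longrightarrow> operator_expansion C u k) \<and>
     (\<forall>k s. 1 \<le> s \<and> s < k \<longrightarrow>
       (\<forall>m \<gamma>. 1 < m \<and> m < s + 1 \<and> \<gamma> \<in> tuples m (s + 1) \<and> \<gamma> (s + 1) = 0 \<longrightarrow>
         C (s + 1) m (k + 1) \<gamma> =
           (\<Sum>t=s+1..k.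
              (of_nat t + 1 - of_nat m) *
                symb C s (m - 1) t ((\<lambda>i. int (\<gamma> i))(1 := int (\<gamma> 1) - 1)) +
              (\<Sum>j=1..s-1. (of_nat (\<gamma> j) + 1) *
                symb C s m t ((\<lambda>i. int (\<gamma> i))
                  (j := int (\<gamma> j) + 1, j + 1 := int (\<gamma> (j + 1)) - 1))))) \<and>
       (\<forall>\<gamma>. \<gamma> \<in> tuples (s + 1) (s + 1) \<and> \<gamma> (s + 1) = 0 \<longrightarrow>
         C (s + 1) (s + 1) (k + 1) \<gamma> =
           (\<Sum>t=s+1..k. (of_nat t - of_nat s) *
              symb C s s t ((\<lambda>i. int (\<gamma> i))(1 := int (\<gamma> 1) - 1)))) \<and>
       C (s + 1) 1 (k + 1) (\<lambda>i. if i = s + 1 then 1 else 0) =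
         (\<Sum>t=s+1..k. C s 1 t (\<lambda>i. if i = s then 1 else 0)))"
proof (intro exI[of _ coeff_C] conjI allI impI)
  fix u k show "operator_expansion coeff_C u k" by (rule operator_expansion_coeff_C)
next
  fix k s m :: nat and \<gamma>
  assume ks: "1 \<le> s \<and> s < k"
    and \<gamma>: "1 < m \<and> m < s + 1 \<and> \<gamma> \<in> tuples m (s + 1) \<and> \<gamma> (s + 1) = 0"
  \<comment> \<open>The recurrence sums up to \<open>j = s\<close>, the claim only up to
    \<open>s - 1\<close>; the last term vanishes because
    \<open>\<gamma> (s + 1) = 0\<close>.\<close>
  obtain s' where "s = Suc s'" using ks by (cases s) auto
  then have "(\<Sum>j=1..s. if \<gamma> (j + 1) = 0 then 0
              else (of_nat (\<gamma> j) + 1) * coeff_C s m t (inc j (dec (j + 1) \<gamma>))) =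
      (\<Sum>j=1..s-1. (of_nat (\<gamma> j) + 1) *
        (if \<gamma> (j + 1) = 0 then 0 else coeff_C s m t (inc j (dec (j + 1) \<gamma>))))" for t
    using \<gamma> by (auto intro!: sum.cong)
  then show "coeff_C (s + 1) m (k + 1) \<gamma> =
           (\<Sum>t=s+1..k.
              (of_nat t + 1 - of_nat m) *
                symb coeff_C s (m - 1) t ((\<lambda>i. int (\<gamma> i))(1 := int (\<gamma> 1) - 1)) +
              (\<Sum>j=1..s-1. (of_nat (\<gamma> j) + 1) *
                symb coeff_C s m t ((\<lambda>i. int (\<gamma> i))
                  (j := int (\<gamma> j) + 1, j + 1 := int (\<gamma> (j + 1)) - 1))))"
    using coeff_C_unroll[of \<gamma> m s k] ks \<gamma> unfolding symb_dec symb_shift by simp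
next
  fix k s :: nat and \<gamma>
  assume ks: "1 \<le> s \<and> s < k" and \<gamma>: "\<gamma> \<in> tuples (s + 1) (s + 1) \<and> \<gamma> (s + 1) = 0"
  \<comment> \<open>Size \<open>s + 1\<close> is impossible in weight \<open>s\<close>, so the shift
    terms drop out, and the remaining factor is \<open>t + 1 - (s + 1) = t - s\<close>.\<close>
  have "coeff_C s (s + 1) t \<alpha> = 0" for t \<alpha>
    using tuples_bounds(1)[of \<alpha> "s + 1" s] by (intro coeff_C_outside) auto
  then show "coeff_C (s + 1) (s + 1) (k + 1) \<gamma> =
           (\<Sum>t=s+1..k. (of_nat t - of_nat s) *
              symb coeff_C s s t ((\<lambda>i. int (\<gamma> i))(1 := int (\<gamma> 1) - 1)))"
    using coeff_C_unroll[of \<gamma> "s + 1" s k] ks \<gamma> unfolding symb_dec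
    by (simp del: coeff_C.simps cong: if_cong)
next
  fix k s :: nat
  assume ks: "1 \<le> s \<and> s < k"
  define \<gamma> :: "nat \<Rightarrow> nat" where "\<gamma> = (\<lambda>i. if i = s + 1 then 1 else 0)"
  have \<gamma>: "\<gamma> \<in> tuples 1 (s + 1)"
    by (auto simp: tuples_def \<gamma>_def if_distrib[of "\<lambda>x. _ * x"] cong: if_cong)
  \<comment> \<open>Size \<open>m - 1 = 0\<close> is impossible in positive weight, which removes
    the first term.\<close>
  have "coeff_C s 0 t \<alpha> = 0" for t \<alpha>
    using tuples_bounds(2)[of \<alpha> 0 s] ks by (intro coeff_C_outside) auto
  \<comment> \<open>Only \<open>j = s\<close> survives, with factor 1 since
    \<open>\<gamma> s = 0\<close>.\<close>
  moreover have "(\<Sum>j=1..s. if \<gamma> (j + 1) = 0 then 0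
              else (of_nat (\<gamma> j) + 1) * coeff_C s 1 t (inc j (dec (j + 1) \<gamma>))) =
      coeff_C s 1 t (\<lambda>i. if i = s then 1 else 0)" for t
  proof -
    have "inc s (dec (s + 1) \<gamma>) = (\<lambda>i. if i = s then 1 else 0)"
      by (auto simp: inc_def dec_def \<gamma>_def)
    moreover have "{1..s} = insert s {1..s-1}" "s \<notin> {1..s-1}" using ks by auto
    ultimately show ?thesis by (auto simp: \<gamma>_def intro!: sum.neutral)
  qed
  ultimately show "coeff_C (s + 1) 1 (k + 1) (\<lambda>i. if i = s + 1 then 1 else 0) =
         (\<Sum>t=s+1..k. coeff_C s 1 t (\<lambda>i. if i = s then 1 else 0))"
    using coeff_C_unroll[OF \<gamma>, of k] ks unfolding \<gamma>_def[symmetric] by (simp del: coeff_C.simps cong: if_cong)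
qed

end
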